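(* Let $H=(V,E)$ be any Greechie diagram of an orthomodular poset (OMP), that is, a Greechie diagram which has no cycle of order less than $4$. Put $n=|V|$ and $m=|E|$. Then $$m \le \frac{n(n+3)}{18}.$$
   Context: A hypergraph is a pair $(V,E)$ where $V$ is a finite set of vertices and $E$ is a set of nonempty subsets of $V$ (edges) with $\bigcup_{e\in E} e = V$. A cycle of order $k\ge 2$ is a sequence $v_1,e_1,v_2,e_2,\ldots,v_k,e_k$ of distinct vertices $v_1,\dots,v_k\in V$ and distinct edges $e_1,\dots,e_k\in E$ such that $v_i,v_{i+1}\in e_i$ for each $i\in\{1,\ldots,k-1\}$ and $v_1,v_k\in e_k$. A Greechie diagram is a finite hypergraph such that for all distinct edges $e,f$ we have $|e\setminus f|\ge 2$ and $|e\cap f|\le 1$. Its vertices represent the atoms of a finite quantum structure and its edges represent the maximal sets of mutually orthogonal atoms. A Greechie diagram represents an orthomodular poset (OMP) if and only if it has no cycle of order less than $4$.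
   Formalization: Added hypothesis: if n ≤ 4, every edge has at least 3 vertices. This excludes only diagrams for which the bound is false: one edge with one vertex, one edge with two vertices, and two disjoint two-vertex edges. *)

theory Defs
  imports Complex_Main
begin

locale hypergraph =
  fixes V :: "'a set" and E :: "'a set set"
  assumes finite_vertices: "finite V"
    and edges_nonempty: "{} \<notin> E"
    and edges_cover: "\<Union>E = V"

(* The sequence v_1, e_1, ..., v_k, e_k is given by two lists of length k, indexed from 0. *)
definition hg_cycle :: "'a set \<Rightarrow> 'a set set \<Rightarrow> nat \<Rightarrow> 'a list \<Rightarrow> 'a set list \<Rightarrow> bool" where
  "hg_cycle V E k vs es \<longleftrightarrow>
     k \<ge> 2 \<and> length vs = k \<and> length es = k \<and>
     distinct vs \<and> distinct es \<and> set vs \<subseteq> V \<and> set es \<subseteq> E \<and>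
     (\<forall>i<k - 1. vs ! i \<in> es ! i \<and> vs ! (i + 1) \<in> es ! i) \<and>
     vs ! 0 \<in> es ! (k - 1) \<and> vs ! (k - 1) \<in> es ! (k - 1)"

locale greechie_diagram = hypergraph V E
  for V :: "'a set" and E :: "'a set set" +
  assumes card_edge_diff: "\<lbrakk>e \<in> E; f \<in> E; e \<noteq> f\<rbrakk> \<Longrightarrow> card (e - f) \<ge> 2"
    and card_edge_inter: "\<lbrakk>e \<in> E; f \<in> E; e \<noteq> f\<rbrakk> \<Longrightarrow> card (e \<inter> f) \<le> 1"

locale greechie_diagram_omp = greechie_diagram V E
  for V :: "'a set" and E :: "'a set set" +
  assumes no_short_cycle: "k < 4 \<Longrightarrow> \<not> hg_cycle V E k vs es"

(* The axioms admit edges with fewer than three vertices, and for three degenerate diagrams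
   the bound m <= n(n+3)/18 is false: a single edge with one vertex (n = m = 1), a single edge
   with two vertices (n = 2, m = 1), and two disjoint edges with two vertices each (n = 4,
   m = 2; the diagram of MO2).  Up to isomorphism these are the diagrams with at most four
   vertices and an edge of fewer than three vertices.  The next lemma shows that excluding them excludes
   no diagram for which the bound holds; the three after it that they do satisfy the axioms. *)
lemma (in greechie_diagram_omp) bound_fails_if_degenerate:
  assumes "card V \<le> 4" "e \<in> E" "card e < 3"
  shows "\<not> real (card E) \<le> real (card V) * (real (card V) + 3) / 18"
proof (cases "E = {e}")
  case True
  then have "card V < 3" using edges_cover assms(3) by auto
  then have "card V = 0 \<or> card V = 1 \<or> card V = 2" by linarith
  then show ?thesis using True by auto
next
  case False
  then obtain f where f: "f \<in> E" "f \<noteq> e" using assms(2) by blast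
  have "E \<subseteq> Pow V" using edges_cover by blast
  then have "finite E" using finite_vertices finite_subset by blast
  then have "card {e, f} \<le> card E" using f assms(2) by (intro card_mono) auto
  then have "2 \<le> card E" using f by simp
  moreover have "real (card V) * (real (card V) + 3) \<le> 4 * (4 + 3)"
    using assms(1) by (intro mult_mono) auto
  ultimately show ?thesis by auto
qed

lemma
  shows degenerate_one_vertex: "greechie_diagram_omp {0::nat} {{0}}"
    and degenerate_two_vertices: "greechie_diagram_omp {0::nat, 1} {{0, 1}}"
    and degenerate_two_edges: "greechie_diagram_omp {0::nat, 1, 2, 3} {{0, 1}, {2, 3}}"
proof -
  have one_edge: "\<not> hg_cycle V {e} k vs es" for V and e :: "nat set" and k vs es
  proof
    assume c: "hg_cycle V {e} k vs es"
    then have "card (set es) \<le> card {e}"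
      unfolding hg_cycle_def by (intro card_mono) auto
    then show False using c by (simp add: hg_cycle_def distinct_card)
  qed
  show "greechie_diagram_omp {0::nat} {{0}}"
    by unfold_locales (auto simp: one_edge)
  show "greechie_diagram_omp {0::nat, 1} {{0, 1}}"
    by unfold_locales (auto simp: one_edge)
  have two_edges: "\<not> hg_cycle V {{0::nat, 1}, {2, 3}} k vs es" for V k vs es
  proof
    assume c: "hg_cycle V {{0::nat, 1}, {2, 3}} k vs es"
    then have k: "k \<ge> 2" "length es = k" "length vs = k" "distinct es"
      and s: "set es \<subseteq> {{0, 1}, {2, 3}}"
      and v: "\<forall>i<k - 1. vs ! i \<in> es ! i \<and> vs ! (i + 1) \<in> es ! i"
        "vs ! 0 \<in> es ! (k - 1)"
      unfolding hg_cycle_def by auto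
    have "card (set es) \<le> card {{0::nat, 1}, {2, 3}}" using s by (intro card_mono) auto
    also have "\<dots> \<le> 2" by (simp add: card_insert_if)
    finally have "k = 2" using k by (simp add: distinct_card)
    have "es ! 0 \<noteq> es ! 1" using k \<open>k = 2\<close> by (subst nth_eq_iff_index_eq) auto
    moreover have "es ! 0 \<in> {{0, 1}, {2, 3}}" "es ! 1 \<in> {{0, 1}, {2, 3}}"
      by (rule subsetD[OF s], rule nth_mem, use k \<open>k = 2\<close> in simp)+
    moreover have "vs ! 0 \<in> es ! 0" "vs ! 0 \<in> es ! 1" using v \<open>k = 2\<close> by auto
    ultimately show False by (elim insertE emptyE) (simp_all, linarith+)
  qed
  have "{0::nat, 1} - {2, 3} = {0, 1}" "{2::nat, 3} - {0, 1} = {2, 3}"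
    "{0::nat, 1} \<inter> {2, 3} = {}" "{2::nat, 3} \<inter> {0, 1} = {}" by auto
  then show "greechie_diagram_omp {0::nat, 1, 2, 3} {{0, 1}, {2, 3}}"
    by unfold_locales (use two_edges in \<open>(elim insertE emptyE; simp) | auto\<close>)+
qed

end

theory Submission imports Defs "HOL-Analysis.Convex" begin

text \<open>
  Suppose first that every edge has exactly three vertices. Fix an edge \<open>t\<close>. Each edge \<open>u \<noteq> t\<close>
  through a vertex of \<open>t\<close> has two vertices outside \<open>t\<close>, and these pairs are disjoint for different
  \<open>u\<close>: two edges sharing such a point would form a cycle of order two or three (with \<open>t\<close> as the third
  edge). Counting vertices gives \<open>3 + 2 * (\<Sum>v\<in>t. (d v - 1)) \<le> n\<close>, where \<open>d\<close> is the degree, that is,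
  \<open>2 * (\<Sum>v\<in>t. d v) \<le> n + 3\<close>. Summing over all edges bounds the sum of the squared degrees:
  \<open>2 * (\<Sum>v. d v ^ 2) \<le> m * (n + 3)\<close>. As the degrees add up to \<open>3 * m\<close>, the
  Cauchy--Schwarz inequality gives \<open>9 * m^2 \<le> n * (\<Sum>v. d v ^ 2)\<close>, and the bound follows
  (\<open>triple_system_bound\<close>).

  Larger edges may be shrunk to three of their vertices: edges share at most one vertex, so they
  stay distinct, and no new incidence is created (\<open>large_edges_bound\<close>).

  An edge with two vertices is disjoint from every other edge, because both of its vertices lie in
  its difference with any other edge. Each of \<open>k\<close> such edges therefore uses up two private vertices
  and adds one to \<open>m\<close>; the bound for the remaining \<open>n'\<close> vertices extends to the whole
  diagram as soon as \<open>n' + k \<ge> 3\<close>, which holds when \<open>n = n' + 2 * k\<close> is at least five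
  (\<open>edge_bound_five_vertices\<close>). On five or more vertices an edge with a single vertex is
  impossible: there would have to be another edge, and it would have to omit two vertices of the
  first. On at most four vertices all edges are large by hypothesis.
\<close>

section \<open>Triangle-free linear triple systems\<close>

text \<open>
  Read together with \<open>linear\<close>, the equation \<open>x = y\<close> in \<open>no_triangle\<close> says that three triples which
  meet pairwise pass through one common point; this allows concurrent triples and forbids
  exactly the cycles of order three.
\<close>

locale triple_system =
  fixes V :: "'a set" and T :: "'a set set"
  assumes finite_points: "finite V"
    and triple_subset: "t \<in> T \<Longrightarrow> t \<subseteq> V"
    and card_triple: "t \<in> T \<Longrightarrow> card t = 3"
    and linear: "\<lbrakk>t \<in> T; u \<in> T; t \<noteq> u; x \<in> t; x \<in> u; y \<in> t; y \<in> u\<rbrakk> \<Longrightarrow> x = y"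
    and no_triangle: "\<lbrakk>t \<in> T; u \<in> T; w \<in> T; t \<noteq> u; u \<noteq> w; w \<noteq> t;
      x \<in> t; x \<in> u; y \<in> u; y \<in> w; z \<in> w; z \<in> t\<rbrakk> \<Longrightarrow> x = y"
begin

definition degree :: "'a \<Rightarrow> nat" where
  "degree v = card {t \<in> T. v \<in> t}"

lemma finite_triples: "finite T"
  using finite_points triple_subset by (meson PowI finite_Pow_iff finite_subset subsetI)

lemma finite_triple: "t \<in> T \<Longrightarrow> finite t"
  using triple_subset finite_points finite_subset by blast

text \<open>
  The sets \<open>u - {v}\<close>, for \<open>v \<in> t\<close> and \<open>u\<close> another triple through \<open>v\<close>, are disjoint from each other
  and from \<open>t\<close>: a shared point would close a triangle with \<open>t\<close> or give two triples with two common
  points. Each has two points, so \<open>t\<close> and these sets together need \<open>3 + 2 * (\<Sum>v\<in>t. (degree v - 1))\<close>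
  points of \<open>V\<close>.
\<close>

lemma degree_sum_triple:
  assumes t: "t \<in> T"
  shows "2 * (\<Sum>v\<in>t. degree v) \<le> card V + 3"
proof -
  define N where "N v = {u \<in> T. v \<in> u} - {t}" for v
  define I where "I = Sigma t N"
  define F where "F = (\<lambda>(v, u). u - {v} :: 'a set)"
  have finN: "finite (N v)" for v
    unfolding N_def using finite_triples by auto
  have finI: "finite I"
    unfolding I_def using finite_triple[OF t] finN by auto
  have "degree v = card (N v) + 1" if "v \<in> t" for v
    unfolding degree_def N_def
    using t that finite_triples by (subst card.remove[of _ t]) auto
  then have "(\<Sum>v\<in>t. degree v) = (\<Sum>v\<in>t. card (N v) + 1)"
    by (intro sum.cong) auto
  also have "\<dots> = card I + 3"
    unfolding I_def sum.distrib using finite_triple[OF t] finN card_triple[OF t]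
    by (simp add: card_SigmaI)
  finally have degrees: "(\<Sum>v\<in>t. degree v) = card I + 3" .
  have cardF: "card (F p) = 2" and finF: "finite (F p)" if "p \<in> I" for p
    using that card_triple finite_triple unfolding I_def F_def N_def by auto
  have disj: "F p \<inter> F q = {}" if "p \<in> I" "q \<in> I" "p \<noteq> q" for p q
  proof -
    obtain v u v' u' where pq: "p = (v, u)" "q = (v', u')" by (cases p, cases q)
    have v: "v \<in> t" "v \<in> u" "u \<in> T" "u \<noteq> t" and v': "v' \<in> t" "v' \<in> u'" "u' \<in> T" "u' \<noteq> t"
      using that pq unfolding I_def N_def by auto
    have False if x: "x \<in> u" "x \<noteq> v" "x \<in> u'" "x \<noteq> v'" for x
    proof (cases "u = u'")
      case True
      then show False using linear[of u t v v'] v v' t \<open>p \<noteq> q\<close> pq by auto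
    next
      case False
      then show False using no_triangle[of t u u' v x v'] v v' t x by auto
    qed
    then show ?thesis unfolding pq F_def by auto
  qed
  have away: "t \<inter> (\<Union>p\<in>I. F p) = {}"
    unfolding I_def F_def N_def by (auto dest: linear[OF t])
  have "card (\<Union>p\<in>I. F p) = (\<Sum>p\<in>I. card (F p))"
    using finI finF disj by (intro card_UN_disjoint) auto
  also have "\<dots> = 2 * card I"
    using cardF by simp
  finally have "card (t \<union> (\<Union>p\<in>I. F p)) = 3 + 2 * card I"
    using finI finF finite_triple[OF t] card_triple[OF t] away
    by (subst card_Un_disjoint) auto
  moreover have "t \<union> (\<Union>p\<in>I. F p) \<subseteq> V"
    using triple_subset t unfolding I_def F_def N_def by fastforce
  ultimately have "3 + 2 * card I \<le> card V"
    using finite_points card_mono by metis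
  then show ?thesis using degrees by simp
qed

lemma sum_over_incidences:
  fixes g :: "'a \<Rightarrow> nat"
  shows "(\<Sum>t\<in>T. \<Sum>v\<in>t. g v) = (\<Sum>v\<in>V. degree v * g v)"
proof -
  have "(\<Sum>t\<in>T. \<Sum>v\<in>t. g v) = (\<Sum>t\<in>T. \<Sum>v\<in>{v \<in> V. v \<in> t}. g v)"
    using triple_subset by (intro sum.cong refl) blast
  also have "\<dots> = (\<Sum>v\<in>V. \<Sum>t\<in>{t \<in> T. v \<in> t}. g v)"
    using finite_triples finite_points by (rule sum.swap_restrict)
  finally show ?thesis by (simp add: degree_def)
qed

text \<open>
  By double counting, the sum of the bounds for the single triples controls the sum of the squared
  degrees; the Cauchy--Schwarz inequality compares it with the square of the degree sum \<open>3 * card T\<close>.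
\<close>

lemma triple_system_bound: "18 * card T \<le> card V * (card V + 3)"
proof (cases "card T = 0")
  case False
  have degrees: "(\<Sum>v\<in>V. degree v) = 3 * card T"
    using sum_over_incidences[of "\<lambda>_. 1"] card_triple by simp
  have "2 * (\<Sum>v\<in>V. degree v * degree v) = (\<Sum>t\<in>T. 2 * (\<Sum>v\<in>t. degree v))"
    by (simp add: sum_over_incidences sum_distrib_left[symmetric])
  also have "\<dots> \<le> (\<Sum>t\<in>T. card V + 3)"
    by (intro sum_mono degree_sum_triple)
  finally have squares: "2 * (\<Sum>v\<in>V. degree v * degree v) \<le> card T * (card V + 3)"
    by simp
  have "(\<Sum>v\<in>V. real (degree v))\<^sup>2 \<le> (\<Sum>v\<in>V. (real (degree v))\<^sup>2) * real (card V)"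
    by (rule sum_squared_le_sum_of_squares)
  then have "real ((\<Sum>v\<in>V. degree v)\<^sup>2) \<le> real ((\<Sum>v\<in>V. degree v * degree v) * card V)"
    by (simp add: power2_eq_square)
  then have "(3 * card T)\<^sup>2 \<le> (\<Sum>v\<in>V. degree v * degree v) * card V"
    unfolding degrees by linarith
  then have "2 * (3 * card T)\<^sup>2 \<le> (2 * (\<Sum>v\<in>V. degree v * degree v)) * card V"
    by (simp only: mult.assoc mult_le_mono2)
  also have "\<dots> \<le> (card T * (card V + 3)) * card V"
    using squares by (rule mult_right_mono) simp
  finally have "card T * (18 * card T) \<le> card T * (card V * (card V + 3))"
    by (simp add: power2_eq_square algebra_simps)
  then show ?thesis using False by simp
qed simp

end

section \<open>Greechie diagrams\<close>

context greechie_diagram_omp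
begin

lemma edge_subset: "e \<in> E \<Longrightarrow> e \<subseteq> V"
  using edges_cover by blast

lemma finite_edges: "finite E"
  using finite_vertices edge_subset by (meson PowI finite_Pow_iff finite_subset subsetI)

lemma finite_edge: "e \<in> E \<Longrightarrow> finite e"
  using edge_subset finite_vertices finite_subset by blast

lemma edges_meet_once:
  assumes "e \<in> E" "f \<in> E" "e \<noteq> f" "x \<in> e" "x \<in> f" "y \<in> e" "y \<in> f"
  shows "x = y"
  using card_edge_inter[OF assms(1-3)] finite_edge[OF assms(1)] assms(4-)
  by (auto simp: card_le_Suc0_iff_eq)

lemma no_edge_triangle:
  assumes "e \<in> E" "f \<in> E" "g \<in> E" "e \<noteq> f" "f \<noteq> g" "g \<noteq> e"
    and "x \<in> e" "x \<in> f" "y \<in> f" "y \<in> g" "z \<in> g" "z \<in> e"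
  shows "x = y"
proof (rule ccontr)
  assume "x \<noteq> y"
  then have "z \<noteq> x" "z \<noteq> y"
    using assms edges_meet_once by metis+
  then have "hg_cycle V E 3 [x, y, z] [f, g, e]"
    using assms edge_subset \<open>x \<noteq> y\<close>
    unfolding hg_cycle_def by (auto simp: less_Suc_eq numeral_eq_Suc)
  then show False using no_short_cycle by simp
qed

text \<open>
  Choosing three vertices from every edge of \<open>A\<close> yields a triple system with as many triples as \<open>A\<close>
  has edges: equal choices for two edges would give these three common vertices. The set \<open>W\<close> is
  arbitrary so that the vertices of the edges outside \<open>A\<close> can be left out of the count.
\<close>

lemma large_edges_bound:
  assumes A: "A \<subseteq> E" "\<And>e. e \<in> A \<Longrightarrow> card e \<ge> 3"
    and W: "W \<subseteq> V" "\<And>e. e \<in> A \<Longrightarrow> e \<subseteq> W"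
  shows "18 * card A \<le> card W * (card W + 3)"
proof -
  have "\<forall>e\<in>A. \<exists>t. t \<subseteq> e \<and> card t = 3"
    using A(2) obtain_subset_with_card_n by metis
  then obtain c where c: "\<And>e. e \<in> A \<Longrightarrow> c e \<subseteq> e" "\<And>e. e \<in> A \<Longrightarrow> card (c e) = 3"
    by metis
  have inj: "inj_on c A"
  proof (rule inj_onI, rule ccontr)
    fix e f
    assume ef: "e \<in> A" "f \<in> A" "c e = c f" "e \<noteq> f"
    have "c e \<subseteq> e \<inter> f" using c ef by blast
    then have "card (c e) \<le> card (e \<inter> f)"
      using A(1) ef finite_edge by (intro card_mono) auto
    also have "\<dots> \<le> 1" using card_edge_inter A(1) ef by blast
    finally show False using c(2) ef by simp
  qed
  interpret triple_system W "c ` A"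
  proof
    show "finite W" using W(1) finite_vertices finite_subset by blast
  next
    fix t assume "t \<in> c ` A"
    then show "t \<subseteq> W" "card t = 3" using c W(2) by blast+
  next
    fix t u x y
    assume "t \<in> c ` A" "u \<in> c ` A" "t \<noteq> u" "x \<in> t" "x \<in> u" "y \<in> t" "y \<in> u"
    moreover from this obtain e f where "e \<in> A" "t = c e" "f \<in> A" "u = c f" by blast
    ultimately show "x = y" using edges_meet_once[of e f x y] c(1) A(1) by blast
  next
    fix t u w x y z
    assume *: "t \<in> c ` A" "u \<in> c ` A" "w \<in> c ` A" "t \<noteq> u" "u \<noteq> w" "w \<noteq> t"
      "x \<in> t" "x \<in> u" "y \<in> u" "y \<in> w" "z \<in> w" "z \<in> t"
    then obtain e f g where **: "e \<in> A" "t = c e" "f \<in> A" "u = c f" "g \<in> A" "w = c g" by blast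
    have "e \<in> E" "f \<in> E" "g \<in> E" "e \<noteq> f" "f \<noteq> g" "g \<noteq> e" using * ** A(1) by auto
    moreover have "x \<in> e" "x \<in> f" "y \<in> f" "y \<in> g" "z \<in> g" "z \<in> e" using * ** c(1) by blast+
    ultimately show "x = y" by (rule no_edge_triangle)
  qed
  show ?thesis using triple_system_bound card_image[OF inj] by simp
qed

text \<open>
  A difference \<open>e - f\<close> has at least two vertices, so it exhausts an edge \<open>e\<close> with at most two.
\<close>

lemma small_edge_isolated:
  assumes "e \<in> E" "card e \<le> 2" "f \<in> E" "f \<noteq> e"
  shows "card e = 2" "e \<inter> f = {}"
proof -
  have "2 \<le> card (e - f)" using card_edge_diff assms by blast
  then have "card e \<le> card (e - f)" using assms(2) by simp
  then have "e - f = e"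
    using finite_edge[OF assms(1)] by (intro card_seteq) auto
  then show "e \<inter> f = {}" "card e = 2" using \<open>2 \<le> card (e - f)\<close> assms(2) by auto
qed

text \<open>
  Adding \<open>k\<close> isolated edges with two vertices each to a diagram on \<open>n'\<close> vertices raises
  \<open>n * (n + 3)\<close> by \<open>2 * k * (2 * n' + 2 * k + 3)\<close>. This pays for the \<open>k\<close> edges, at \<open>18\<close> each,
  if \<open>n' + k \<ge> 3\<close>, which follows from \<open>n' + 2 * k \<ge> 5\<close>.
\<close>

lemma edge_bound_five_vertices:
  assumes n: "card V \<ge> 5"
  shows "18 * card E \<le> card V * (card V + 3)"
proof -
  define B where "B = {e \<in> E. card e \<le> 2}"
  define A where "A = {e \<in> E. card e \<ge> 3}"
  define W where "W = V - \<Union>B"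
  have fin: "finite A" "finite B" using finite_edges unfolding A_def B_def by auto
  have "E = A \<union> B" "A \<inter> B = {}" unfolding A_def B_def by auto
  then have m: "card E = card A + card B" using fin card_Un_disjoint by metis
  have card2: "card e = 2" if "e \<in> B" for e
  proof -
    \<comment> \<open>A small edge cannot cover five vertices, so there is another edge.\<close>
    have e: "e \<in> E" "card e \<le> 2" using that B_def by auto
    then have "\<not> \<Union>E \<subseteq> e"
      using n edges_cover card_mono[OF finite_edge[OF e(1)], of V] by auto
    then obtain f where "f \<in> E" "f \<noteq> e" by blast
    then show ?thesis using small_edge_isolated e by blast
  qed
  have "card (\<Union>B) = (\<Sum>e\<in>B. card e)"
    using small_edge_isolated(2) finite_edge unfolding B_def
    by (intro card_Union_disjoint) (auto simp: pairwise_def disjnt_def)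
  then have "card (\<Union>B) = 2 * card B" using card2 by simp
  moreover have "\<Union>B \<subseteq> V" using edge_subset unfolding B_def by blast
  ultimately have nW: "card V = card W + 2 * card B"
    using finite_vertices unfolding W_def
    by (metis card_Diff_subset card_mono finite_subset le_add_diff_inverse2)
  have "e \<subseteq> W" if "e \<in> A" for e
    using that small_edge_isolated(2) edge_subset unfolding A_def B_def W_def by fastforce
  then have large: "18 * card A \<le> card W * (card W + 3)"
    unfolding A_def W_def by (intro large_edges_bound) auto
  have "3 \<le> card W + card B" using n nW by presburger
  then have "card B * 3 \<le> card B * (card W + card B)" by (rule mult_le_mono2)
  then have "18 * card B \<le> 2 * card B * (2 * card W + 2 * card B + 3)"
    by (simp add: algebra_simps)
  also have "card W * (card W + 3) + \<dots> = card V * (card V + 3)"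
    unfolding nW by (simp add: algebra_simps)
  finally show ?thesis using large m by linarith
qed

end

theorem theorem2:
  fixes V :: "'a set" and E :: "'a set set"
  assumes "greechie_diagram_omp V E"
    and nondegenerate: "card V \<le> 4 \<longrightarrow> (\<forall>e\<in>E. card e \<ge> 3)"
  shows "real (card E) \<le> real (card V) * (real (card V) + 3) / 18"
proof -
  interpret greechie_diagram_omp V E by fact
  have "18 * card E \<le> card V * (card V + 3)"
  proof (cases "card V \<le> 4")
    case True
    then show ?thesis using nondegenerate edge_subset by (intro large_edges_bound) auto
  next
    case False
    then show ?thesis by (intro edge_bound_five_vertices) simp
  qed
  then have "real (18 * card E) \<le> real (card V * (card V + 3))"
    by (simp only: of_nat_le_iff)
  then show ?thesis by (simp add: field_simps)
qed

end
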